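(* Let $$\mathcal{P}=\{\bm x\in\mathbb{R}^K:\bm S\bm x\le\bm t,\ \|\bm Q_i\bm x+\bm q_i\|^2\le1\ \ \forall i\in[I]\},$$ where $\bm S\in\mathbb{R}^{J\times K}$, $\bm t\in\mathbb{R}^J$, $\bm Q_i\in\mathbb{S}^K$, $\bm q_i\in\mathbb{R}^K$. Let $\bm A\in\mathbb{S}^K_{++}$ and $\bm b\in\mathbb{R}^K$. Then the ellipsoid $\mathcal{E}(\bm A,\bm b)=\{\bm x\in\mathbb{R}^K:\|\bm A\bm x+\bm b\|^2\le1\}$ contains $\mathcal{P}$ if there exist $\bm N\in\mathbb{R}_+^{J\times J}$, $\bm F\in\mathbb{S}^K$, $\bm g\in\mathbb{R}^K$, $h\in\mathbb{R}$, $\lambda_i\ge0$ for $i\in[I]$, and $\bm\alpha_{ij}\in\mathbb{R}^K$, $\kappa_{ij}\in\mathbb{R}$ for $i\in[I]$, $j\in[J]$, such that $$\|\bm\alpha_{ij}\|\le\kappa_{ij}\quad\forall i\in[I],\ \forall j\in[J],$$ $$\begin{bmatrix}\bm F&\bm g\\ \bm g^\top&h-1\end{bmatrix}\preceq-\bm{\mathcal S}^\top\bm N\bm{\mathcal S}+\sum_{i\in[I]}\lambda_i\bm J_i-\sum_{i\in[I],\,j\in[J]}\bm M_{ij}(\bm\alpha_{ij},\kappa_{ij}),$$ $$\begin{bmatrix}\bm F&\bm g&\bm A\\ \bm g^\top&h&\bm b^\top\\ \bm A&\bm b&\mathbb{I}\end{bmatrix}\succeq\bm 0,$$ where $\bm{\mathcal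 S}=\begin{bmatrix}-\bm S&\bm t\end{bmatrix}\in\mathbb{R}^{J\times(K+1)}$, $$\bm J_i=\begin{bmatrix}\bm Q_i^2&\bm Q_i^\top\bm q_i\\ \bm q_i^\top\bm Q_i&\bm q_i^\top\bm q_i-1\end{bmatrix}\in\mathbb{S}^{K+1},$$ $$\bm M_{ij}(\bm\alpha,\kappa)=\begin{bmatrix}-\frac12\left(\bm S_{j:}\bm\alpha^\top\bm Q_i+\bm Q_i\bm\alpha\bm S_{j:}^\top\right)&\frac12\left(t_j\bm Q_i\bm\alpha-(\bm\alpha^\top\bm q_i+\kappa)\bm S_{j:}\right)\\ \frac12\left(t_j\bm Q_i\bm\alpha-(\bm\alpha^\top\bm q_i+\kappa)\bm S_{j:}\right)^\top&(\bm\alpha^\top\bm q_i+\kappa)t_j\end{bmatrix}.$$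
   Context: $[I]=\{1,\dots,I\}$. $\mathbb{S}^K$, $\mathbb{S}^K_{++}$ are the real symmetric and symmetric positive definite $K\times K$ matrices; $\mathbb{R}^{J\times J}_+$ is the set of entrywise nonnegative matrices; $\mathbb{I}$ is the identity; $\|\cdot\|$ is the Euclidean norm; $\bm S_{j:}\in\mathbb{R}^K$ is the transpose of the $j$-th row of $\bm S$. Vector inequalities are componentwise. $\bm P\succeq\bm Q$ (equivalently $\bm Q\preceq\bm P$) means $\bm P-\bm Q$ is symmetric positive semidefinite. *)

theory Defs
  imports "HOL-Analysis.Analysis"
begin

definition symmetric_matrix :: "real^'n^'n \<Rightarrow> bool" where
  "symmetric_matrix A \<longleftrightarrow> transpose A = A"

definition pos_def :: "real^'n^'n \<Rightarrow> bool" where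
  "pos_def A \<longleftrightarrow> symmetric_matrix A \<and> (\<forall>x. x \<noteq> 0 \<longrightarrow> 0 < x \<bullet> (A *v x))"

definition pos_semidef :: "real^'n^'n \<Rightarrow> bool" where
  "pos_semidef A \<longleftrightarrow> symmetric_matrix A \<and> (\<forall>x. 0 \<le> x \<bullet> (A *v x))"

definition loewner_le :: "real^'n^'n \<Rightarrow> real^'n^'n \<Rightarrow> bool" where
  "loewner_le A B \<longleftrightarrow> pos_semidef (B - A)"

text \<open>Block matrices are indexed by sum types; a single row or column is indexed by the
  one-element type \<open>1\<close>, so that \<open>'k + 1\<close> is the index type of the \<open>(K+1)\<close>-dimensional space
  and \<open>mat h :: real^1^1\<close> is the scalar block \<open>h\<close>.\<close>

definition hcat :: "real^'n^'m \<Rightarrow> real^'p^'m \<Rightarrow> real^('n + 'p)^'m" where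
  "hcat A B = (\<chi> i j. case j of Inl k \<Rightarrow> A $ i $ k | Inr l \<Rightarrow> B $ i $ l)"

definition vcat :: "real^'n^'m \<Rightarrow> real^'n^'p \<Rightarrow> real^'n^('m + 'p)" where
  "vcat A B = (\<chi> i. case i of Inl k \<Rightarrow> A $ k | Inr l \<Rightarrow> B $ l)"

definition outer :: "real^'m \<Rightarrow> real^'n \<Rightarrow> real^'n^'m" where
  "outer u v = (columnvector u :: real^1^'m) ** (rowvector v :: real^'n^1)"

definition ellipsoid :: "real^'k^'k \<Rightarrow> real^'k \<Rightarrow> (real^'k) set" where
  "ellipsoid A b = {x. (norm (A *v x + b))\<^sup>2 \<le> 1}"

definition S_aug :: "real^'k^'j \<Rightarrow> real^'j \<Rightarrow> real^('k + 1)^'j" where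
  "S_aug S t = hcat (- S) (columnvector t)"

definition J_mat :: "real^'k^'k \<Rightarrow> real^'k \<Rightarrow> real^('k + 1)^('k + 1)" where
  "J_mat Q q = vcat
     (hcat (Q ** Q)                   (columnvector (transpose Q *v q)))
     (hcat (rowvector q ** Q)         (mat (q \<bullet> q - 1)))"

definition M_mat :: "real^'k^'j \<Rightarrow> real^'j \<Rightarrow> real^'k^'k \<Rightarrow> real^'k \<Rightarrow> 'j
    \<Rightarrow> real^'k \<Rightarrow> real \<Rightarrow> real^('k + 1)^('k + 1)" where
  "M_mat S t Q q j \<alpha> \<kappa> =
    (let v = (1/2) *\<^sub>R ((t $ j) *\<^sub>R (Q *v \<alpha>) - (\<alpha> \<bullet> q + \<kappa>) *\<^sub>R row j S)
     in vcat
       (hcat (- ((1/2) *\<^sub>R (outer (row j S) \<alpha> ** Q + Q ** outer \<alpha> (row j S)))) (columnvector v))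
       (hcat (rowvector v) (mat ((\<alpha> \<bullet> q + \<kappa>) * t $ j))))"

end

theory Submission
  imports Defs
begin

text \<open>Evaluate the first matrix inequality at \<open>(x, 1)\<close>. The form of \<open>M_mat\<close> there is the product
  \<open>(t\<^sub>j - S\<^sub>j x) (\<alpha> \<bullet> (Q x + q) + \<kappa>)\<close> of two factors that are nonnegative on the feasible set (the
  second one by Cauchy-Schwarz), so the left-hand form satisfies
  \<open>x \<bullet> F x + 2 (g \<bullet> x) + h \<le> 1\<close>. Evaluating the second matrix at \<open>(x, 1, -(A x + b))\<close>, which is the
  minimiser over the last block, bounds \<open>\<parallel>A x + b\<parallel>\<^sup>2\<close> by the same quantity.\<close>

text \<open>Vector counterpart of \<open>vcat\<close>, so that block matrices act blockwise. In
  \<open>vjoin x 1\<close> the \<open>1\<close> is the constant vector of \<open>real^1\<close>,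
  which makes this the homogenised point \<open>(x, 1)\<close>.\<close>

definition vjoin :: "real^'m \<Rightarrow> real^'p \<Rightarrow> real^('m + 'p)" where
  "vjoin u v = (\<chi> i. case i of Inl k \<Rightarrow> u $ k | Inr l \<Rightarrow> v $ l)"

lemma sum_UNIV_sum_type:
  fixes f :: "'a::finite + 'b::finite \<Rightarrow> real"
  shows "sum f UNIV = (\<Sum>k\<in>UNIV. f (Inl k)) + (\<Sum>l\<in>UNIV. f (Inr l))"
  unfolding UNIV_Plus_UNIV[symmetric] by (subst sum.Plus) (auto simp: o_def)

lemma vcat_mult_vec: "vcat A B *v z = vjoin (A *v z) (B *v z)"
  by (auto simp: vec_eq_iff vcat_def vjoin_def matrix_vector_mult_def split: sum.split)

lemma hcat_mult_vjoin: "hcat A B *v vjoin u v = A *v u + B *v v"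
  by (simp add: vec_eq_iff hcat_def vjoin_def matrix_vector_mult_def sum_UNIV_sum_type)

lemma inner_vjoin: "vjoin a b \<bullet> vjoin c d = a \<bullet> c + b \<bullet> d"
  by (simp add: inner_vec_def vjoin_def sum_UNIV_sum_type)

lemma columnvector_mult_vec: "columnvector v *v (u :: real^1) = u $ 1 *\<^sub>R v"
  by (simp add: vec_eq_iff columnvector_def matrix_vector_mult_def)

lemma rowvector_mult_vec: "(rowvector v :: real^'n^1) *v u = vec (v \<bullet> u)"
  by (simp add: vec_eq_iff rowvector_def matrix_vector_mult_def inner_vec_def)

lemma mat_mult_vec: "(mat c :: real^'n^'n) *v u = c *\<^sub>R u"
proof -
  have "(mat c :: real^'n^'n) = c *\<^sub>R mat 1"
    by (simp add: vec_eq_iff mat_def)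
  then show ?thesis
    by (simp add: scaleR_matrix_vector_assoc[symmetric])
qed

lemma outer_mult_vec: "outer u v *v x = (v \<bullet> x) *\<^sub>R u"
  by (simp add: outer_def matrix_vector_mul_assoc[symmetric] columnvector_mult_vec rowvector_mult_vec)

lemma inner_real1: "(u :: real^1) \<bullet> v = u $ 1 * v $ 1"
  by (simp add: inner_vec_def)

lemma inner_symmetric_matrix:
  assumes "symmetric_matrix A"
  shows "x \<bullet> (A *v y) = (A *v x) \<bullet> y"
  using assms by (metis dot_lmul_matrix symmetric_matrix_def transpose_matrix_vector)

lemma minus_mult_vec: "(- A) *v x = - (A *v (x :: real^'n))" for A :: "real^'n^'m"
  by (simp add: vec_eq_iff matrix_vector_mult_def sum_negf)

lemma mult_vec_minus: "A *v (- x) = - (A *v (x :: real^'n))" for A :: "real^'n^'m"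
  by (simp add: vec_eq_iff matrix_vector_mult_def sum_negf)

lemma sum_mult_vec: "(\<Sum>i\<in>X. f i) *v x = (\<Sum>i\<in>X. f i *v x)" for f :: "'i \<Rightarrow> real^'n^'m"
  by (induction X rule: infinite_finite_induct)
     (simp_all add: matrix_vector_mult_add_rdistrib)

text \<open>The two borders \<open>g\<close> and \<open>g'\<close> are kept apart because the
  off-diagonal blocks of \<open>J_mat\<close> are written differently and agree only once
  \<open>Q\<close> is known to be symmetric.\<close>

lemma quadratic_form_bordered:
  "vjoin x 1 \<bullet> (vcat (hcat F (columnvector g)) (hcat (rowvector g') (mat c :: real^1^1))
      *v vjoin x 1) = x \<bullet> (F *v x) + x \<bullet> g + g' \<bullet> x + c"
  by (simp add: vcat_mult_vec hcat_mult_vjoin inner_vjoin columnvector_mult_vec rowvector_mult_vec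
      mat_mult_vec inner_real1 inner_add_right)

text \<open>Homogenisation turns the linear constraints into their slack vector, so the term with
  \<open>N\<close> becomes a quadratic form in the slacks.\<close>

lemma S_aug_mult_vec: "S_aug S t *v vjoin x 1 = t - S *v x"
  by (simp add: S_aug_def hcat_mult_vjoin columnvector_mult_vec minus_mult_vec)

lemma quadratic_form_J_mat:
  assumes "symmetric_matrix Q"
  shows "vjoin x 1 \<bullet> (J_mat Q q *v vjoin x 1) = (norm (Q *v x + q))\<^sup>2 - 1"
proof -
  \<comment> \<open>Entrywise symmetry, used to read the lower border of \<open>J_mat\<close> as the
    transpose of the upper one.\<close>
  have "Q $ k $ j = Q $ j $ k" for k j
    using assms unfolding symmetric_matrix_def by (metis transpose_def vec_lambda_beta)
  then have row: "rowvector q ** Q = rowvector (Q *v q)"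
    by (simp add: vec_eq_iff rowvector_def matrix_matrix_mult_def matrix_vector_mult_def
        mult.commute)
  show ?thesis
    unfolding J_mat_def row quadratic_form_bordered
    using assms inner_symmetric_matrix[OF assms]
    by (simp add: symmetric_matrix_def power2_norm_eq_inner inner_add_left inner_add_right
        inner_commute matrix_vector_mul_assoc[symmetric])
qed

text \<open>Expanding the product gives four groups of terms. The one bilinear in
  \<open>S *v x\<close> and \<open>Q *v x\<close> comes from the leading block, whose two halves
  coincide by symmetry of \<open>Q\<close>; the borders give the two mixed groups and the corner
  gives the constant.\<close>

lemma quadratic_form_M_mat:
  assumes "symmetric_matrix Q"
  shows "vjoin x 1 \<bullet> (M_mat S t Q q j \<alpha> \<kappa> *v vjoin x 1)
    = (t $ j - (S *v x) $ j) * (\<alpha> \<bullet> (Q *v x + q) + \<kappa>)"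
proof -
  have row: "row j S \<bullet> x = (S *v x) $ j" for x
    by (simp add: matrix_vector_mul_component row_def)
  have Q: "x \<bullet> (Q *v \<alpha>) = \<alpha> \<bullet> (Q *v x)"
    using inner_symmetric_matrix[OF assms] by (simp add: inner_commute)
  show ?thesis
    unfolding M_mat_def Let_def quadratic_form_bordered
    by (simp add: minus_mult_vec scaleR_matrix_vector_assoc[symmetric] matrix_vector_mult_add_rdistrib
        matrix_vector_mul_assoc[symmetric] outer_mult_vec matrix_vector_mult_scaleR
        inner_add_right inner_diff_right inner_diff_left Q row inner_commute[of x "row j S"]
        inner_commute[of "Q *v \<alpha>" x] algebra_simps)
qed

text \<open>The inner product is at least \<open>- norm u * norm v\<close>, hence at least
  \<open>- norm u\<close>, hence at least \<open>- \<kappa>\<close>.\<close>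

lemma inner_plus_bound_nonneg:
  fixes u v :: "'a::real_inner"
  assumes "norm u \<le> \<kappa>" "(norm v)\<^sup>2 \<le> 1"
  shows "0 \<le> u \<bullet> v + \<kappa>"
proof -
  have "norm v \<le> 1"
    using assms(2) by (simp add: power_le_one_iff abs_square_le_1)
  then have "norm u * norm v \<le> norm u"
    by (simp add: mult_left_le)
  moreover have "\<bar>u \<bullet> v\<bar> \<le> norm u * norm v"
    by (rule Cauchy_Schwarz_ineq2)
  ultimately show ?thesis
    using assms(1) by linarith
qed

text \<open>An entrywise nonnegative matrix is copositive: every term of the double sum is a product
  of nonnegative factors.\<close>

lemma quadratic_form_nonneg_matrix:
  fixes N :: "real^'n^'n"
  assumes "\<forall>j l. 0 \<le> N $ j $ l" "\<forall>j. 0 \<le> s $ j"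
  shows "0 \<le> s \<bullet> (N *v s)"
  using assms by (auto simp: inner_vec_def matrix_vector_mult_def intro!: sum_nonneg mult_nonneg_nonneg)

text \<open>One direction of the Schur complement criterion for the identity block, obtained from a
  single test vector.\<close>

lemma norm_sq_le_of_schur_block:
  fixes A F :: "real^'k^'k"
  assumes "symmetric_matrix A"
    and "pos_semidef
           (vcat (hcat F (hcat (columnvector g) A))
           (vcat (hcat (rowvector g) (hcat (mat h) (rowvector b)))
                 (hcat A (hcat (columnvector b) (mat 1)))) :: real^('k + (1 + 'k))^('k + (1 + 'k)))"
  shows "(norm (A *v x + b))\<^sup>2 \<le> x \<bullet> (F *v x) + 2 * (g \<bullet> x) + h"
proof -
  define y where "y = A *v x + b"
  have "0 \<le> x \<bullet> (F *v x) + 2 * (g \<bullet> x) + h - x \<bullet> (A *v y) - b \<bullet> y - y \<bullet> (A *v x) - y \<bullet> b + y \<bullet> y"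
    using assms(2)[unfolded pos_semidef_def, THEN conjunct2, rule_format,
        of "vjoin x (vjoin 1 (- y))"]
    by (simp add: vcat_mult_vec hcat_mult_vjoin inner_vjoin columnvector_mult_vec rowvector_mult_vec
        mat_mult_vec inner_real1 inner_add_right mult_vec_minus inner_commute
        algebra_simps)
  \<comment> \<open>Each of the two pairs of cross terms equals \<open>y \<bullet> y\<close>; here
    symmetry of \<open>A\<close> moves it onto \<open>x\<close>. Together with the
    \<open>+ y \<bullet> y\<close> of the identity block, exactly one \<open>- y \<bullet> y\<close>
    remains.\<close>
  also have "x \<bullet> (A *v y) + b \<bullet> y = y \<bullet> y"
    unfolding inner_symmetric_matrix[OF assms(1)] by (simp add: y_def inner_add_left)
  moreover have "y \<bullet> (A *v x) + y \<bullet> b = y \<bullet> y"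
    by (simp add: y_def inner_add_right)
  ultimately show ?thesis
    unfolding y_def[symmetric] power2_norm_eq_inner by linarith
qed

theorem theorem4:
  fixes S :: "real^'k^'j" and t :: "real^'j"
    and I :: nat and Q :: "nat \<Rightarrow> real^'k^'k" and q :: "nat \<Rightarrow> real^'k"
    and A :: "real^'k^'k" and b :: "real^'k"
  assumes "\<forall>i\<in>{1..I}. symmetric_matrix (Q i)"
    and "pos_def A"
    and "\<exists>(N :: real^'j^'j) (F :: real^'k^'k) (g :: real^'k) (h :: real) (lam :: nat \<Rightarrow> real)
           (\<alpha> :: nat \<Rightarrow> 'j \<Rightarrow> real^'k) (\<kappa> :: nat \<Rightarrow> 'j \<Rightarrow> real).
         (\<forall>j l. 0 \<le> N $ j $ l) \<and>
         symmetric_matrix F \<and>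
         (\<forall>i\<in>{1..I}. 0 \<le> lam i) \<and>
         (\<forall>i\<in>{1..I}. \<forall>j. norm (\<alpha> i j) \<le> \<kappa> i j) \<and>
         loewner_le
           (vcat (hcat F (columnvector g))
                 (hcat (rowvector g) (mat (h - 1))) :: real^('k + 1)^('k + 1))
           (- (transpose (S_aug S t) ** N ** S_aug S t)
            + (\<Sum>i\<in>{1..I}. lam i *\<^sub>R J_mat (Q i) (q i))
            - (\<Sum>i\<in>{1..I}. \<Sum>j\<in>UNIV. M_mat S t (Q i) (q i) j (\<alpha> i j) (\<kappa> i j))) \<and>
         pos_semidef
           (vcat (hcat F (hcat (columnvector g) A))
           (vcat (hcat (rowvector g) (hcat (mat h) (rowvector b)))
                 (hcat A (hcat (columnvector b) (mat 1)))) :: real^('k + (1 + 'k))^('k + (1 + 'k)))"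
  shows "{x :: real^'k. S *v x \<le> t \<and> (\<forall>i\<in>{1..I}. (norm (Q i *v x + q i))\<^sup>2 \<le> 1)}
           \<subseteq> ellipsoid A b"
proof
  fix x
  assume "x \<in> {x :: real^'k. S *v x \<le> t \<and> (\<forall>i\<in>{1..I}. (norm (Q i *v x + q i))\<^sup>2 \<le> 1)}"
  then have slack: "0 \<le> (t - S *v x) $ j" and ball: "i \<in> {1..I} \<Longrightarrow> (norm (Q i *v x + q i))\<^sup>2 \<le> 1" for i j
    by (simp_all add: less_eq_vec_def)
  obtain N :: "real^'j^'j" and F g h lam \<alpha> \<kappa> where
    N: "\<forall>j l. 0 \<le> N $ j $ l" and lam: "\<forall>i\<in>{1..I}. 0 \<le> lam i"
    and \<alpha>: "\<forall>i\<in>{1..I}. \<forall>j. norm (\<alpha> i j) \<le> \<kappa> i j"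
    and le: "loewner_le
           (vcat (hcat F (columnvector g))
                 (hcat (rowvector g) (mat (h - 1))) :: real^('k + 1)^('k + 1))
           (- (transpose (S_aug S t) ** N ** S_aug S t)
            + (\<Sum>i\<in>{1..I}. lam i *\<^sub>R J_mat (Q i) (q i))
            - (\<Sum>i\<in>{1..I}. \<Sum>j\<in>UNIV. M_mat S t (Q i) (q i) j (\<alpha> i j) (\<kappa> i j)))"
    and schur: "pos_semidef
           (vcat (hcat F (hcat (columnvector g) A))
           (vcat (hcat (rowvector g) (hcat (mat h) (rowvector b)))
                 (hcat A (hcat (columnvector b) (mat 1)))) :: real^('k + (1 + 'k))^('k + (1 + 'k)))"
    using assms(3) by blast
  let ?z = "vjoin x 1 :: real^('k + 1)"
  \<comment> \<open>The transposed factor moves to the other side of the inner product, where it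
    also produces the slack vector.\<close>
  have "?z \<bullet> ((transpose (S_aug S t) ** N ** S_aug S t) *v ?z) = (t - S *v x) \<bullet> (N *v (t - S *v x))"
    by (simp only: matrix_vector_mul_assoc[symmetric] S_aug_mult_vec transpose_matrix_vector
        dot_lmul_matrix inner_commute[of ?z])
       (rule inner_commute)
  also have "\<dots> \<ge> 0"
    using quadratic_form_nonneg_matrix N slack by blast
  finally have n: "0 \<le> ?z \<bullet> ((transpose (S_aug S t) ** N ** S_aug S t) *v ?z)" .
  \<comment> \<open>On the feasible set each form of \<open>J_mat\<close> is a squared norm minus 1,
    hence nonpositive.\<close>
  have l: "(\<Sum>i\<in>{1..I}. lam i * (?z \<bullet> (J_mat (Q i) (q i) *v ?z))) \<le> 0"
    using assms(1) lam ball by (intro sum_nonpos) (simp add: quadratic_form_J_mat mult_nonneg_nonpos)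
  have m: "0 \<le> (\<Sum>i\<in>{1..I}. \<Sum>j\<in>UNIV. ?z \<bullet> (M_mat S t (Q i) (q i) j (\<alpha> i j) (\<kappa> i j) *v ?z))"
  proof (intro sum_nonneg)
    fix i j assume i: "i \<in> {1..I}"
    then have "0 \<le> \<alpha> i j \<bullet> (Q i *v x + q i) + \<kappa> i j"
      using \<alpha> ball by (intro inner_plus_bound_nonneg) auto
    with slack[of j] i assms(1)
    show "0 \<le> ?z \<bullet> (M_mat S t (Q i) (q i) j (\<alpha> i j) (\<kappa> i j) *v ?z)"
      by (simp add: quadratic_form_M_mat)
  qed
  \<comment> \<open>The Loewner inequality tested at \<open>?z\<close>, with the form distributed
    over the three groups of terms.\<close>
  have "?z \<bullet> (vcat (hcat F (columnvector g)) (hcat (rowvector g) (mat (h - 1))) *v ?z)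
    \<le> - (?z \<bullet> ((transpose (S_aug S t) ** N ** S_aug S t) *v ?z))
      + (\<Sum>i\<in>{1..I}. lam i * (?z \<bullet> (J_mat (Q i) (q i) *v ?z)))
      - (\<Sum>i\<in>{1..I}. \<Sum>j\<in>UNIV. ?z \<bullet> (M_mat S t (Q i) (q i) j (\<alpha> i j) (\<kappa> i j) *v ?z))"
    using le[unfolded loewner_le_def pos_semidef_def, THEN conjunct2, rule_format, of ?z]
    by (simp only: matrix_vector_mult_add_rdistrib matrix_vector_mult_diff_rdistrib minus_mult_vec
        sum_mult_vec scaleR_matrix_vector_assoc[symmetric] inner_add_right inner_diff_right
        inner_minus_right inner_sum_right inner_scaleR_right)
  \<comment> \<open>By \<open>n\<close>, \<open>l\<close> and \<open>m\<close> the right-hand side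
    is at most 0; the corner entry \<open>h - 1\<close> then supplies the bound 1.\<close>
  with n l m have "x \<bullet> (F *v x) + 2 * (g \<bullet> x) + h \<le> 1"
    unfolding quadratic_form_bordered by (simp add: inner_commute)
  moreover have "(norm (A *v x + b))\<^sup>2 \<le> x \<bullet> (F *v x) + 2 * (g \<bullet> x) + h"
    using assms(2) schur by (intro norm_sq_le_of_schur_block) (simp_all add: pos_def_def)
  ultimately show "x \<in> ellipsoid A b"
    by (simp add: ellipsoid_def)
qed

end
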